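(* Let $(H,d)$ be a Hadamard space. Then the following hold: (i) $\tau_w$ is coarser than $\tau_K$, i.e. $\tau_w\subseteq\tau_K$. (ii) If $(H,d)$ is locally compact, then Kakavandi convergence and weak convergence coincide: for every sequence $(x_n)\subseteq H$ and $x\in H$, $x_n\overset{K}\to x$ if and only if $x_n\overset{w}\to x$.
   Context: A Hadamard space is a complete $\mathrm{CAT}(0)$ space. For $x\in H$, $\Gamma_x(H)$ is the set of all constant speed geodesics $\gamma:[0,1]\to H$ (i.e. $d(\gamma(s),\gamma(t))=|s-t|\,d(\gamma(0),\gamma(1))$ for all $s,t\in[0,1]$) with $\gamma(0)=x$. For a geodesic $\gamma$, $P_\gamma$ denotes the metric projection onto (the image of) $\gamma$. Weak convergence: $x_n\overset{w}\to x$ means $P_\gamma x_n\to x$ in the metric $d$ for every $\gamma\in\Gamma_x(H)$. Weak topology $\tau_w$: a set $U\subset H$ is weakly open if for every $x\in U$ there exist $\varepsilon>0$ and finitely many $\gamma_1,\dots,\gamma_n\in\Gamma_x(H)$ with $\{y\in H: d(x,P_{\gamma_i}y)<\varepsilon,\ i=1,\dots,n\}\subseteq U$. The weakly open sets (together with $\emptyset$) form the topology $\tau_w$. Quasi-inner product: for $x,y,z,w\in H$, $$\langle\overrightarrow{xz},\overrightarrow{yw}\rangle:=\tfrac12\big(d(x,y)^2+d(z,w)^2-d(x,w)^2-d(z,y)^2\big)$$ as printed in the paper; in particular the expression $\langle\overrightarrow{xz},\overrightarrow{xy}\rangle$ used below is to be read as $\tfrac12\big(d(x,z)^2+d(x,y)^2-d(z,y)^2\big)$.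 Kakavandi convergence: $x_n\overset{K}\to x$ means $\lim_{n\to\infty}\langle\overrightarrow{xx_n},\overrightarrow{xy}\rangle=0$ for all $y\in H$. Kakavandi topology $\tau_K$: the topology on $H$ with subbasis $\{W(x,y;\varepsilon): x,y\in H,\ \varepsilon>0\}$, where $W(x,y;\varepsilon):=\{z\in H: |\langle\overrightarrow{xz},\overrightarrow{xy}\rangle|<\varepsilon\}$. *)

theory Defs
  imports "HOL-Analysis.Analysis"
begin

section \<open>Geodesics and Hadamard spaces\<close>

text \<open>
  Geodesics $[0,1] \to H$ are represented by total functions on the reals; their values
  outside of the unit interval are irrelevant everywhere below.
\<close>

definition (in metric_space) const_speed_geodesic :: "(real \<Rightarrow> 'a) \<Rightarrow> bool" where
  "const_speed_geodesic \<gamma> \<longleftrightarrow>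
     (\<forall>s\<in>{0..1}. \<forall>t\<in>{0..1}. dist (\<gamma> s) (\<gamma> t) = \<bar>s - t\<bar> * dist (\<gamma> 0) (\<gamma> 1))"

definition (in metric_space) geodesic_joins :: "(real \<Rightarrow> 'a) \<Rightarrow> 'a \<Rightarrow> 'a \<Rightarrow> bool" where
  "geodesic_joins \<gamma> x y \<longleftrightarrow> const_speed_geodesic \<gamma> \<and> \<gamma> 0 = x \<and> \<gamma> 1 = y"

text \<open>
  The CAT(0) inequality compares a geodesic triangle with sides \<open>\<alpha>\<close>, \<open>\<beta>\<close>, \<open>\<gamma>\<close> with its
  comparison triangle \<open>p'\<close>, \<open>q'\<close>, \<open>r'\<close> in the Euclidean plane (which always exists and is unique
  up to isometry). The inequality is stated for points on the sides \<open>\<alpha>\<close> and \<open>\<beta>\<close>; cyclically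
  permuting the vertices yields it for the other two pairs of sides, and for two points on the
  same side it holds with equality by the definition of a geodesic.
\<close>

class cat0_space = metric_space +
  assumes geodesic_exists: "\<exists>\<gamma>. geodesic_joins \<gamma> x y"
    and cat0_inequality:
      "\<And>(p' :: real ^ 2) (q' :: real ^ 2) (r' :: real ^ 2) s t.
         \<lbrakk>geodesic_joins \<alpha> p q; geodesic_joins \<beta> q r; geodesic_joins \<gamma> r p;
          norm (p' - q') = dist p q; norm (q' - r') = dist q r; norm (r' - p') = dist r p;
          s \<in> {0..1}; t \<in> {0..1}\<rbrakk>
         \<Longrightarrow> dist (\<alpha> s) (\<beta> t)
               \<le> norm (((1 - s) *\<^sub>R p' + s *\<^sub>R q') - ((1 - t) *\<^sub>R q' + t *\<^sub>R r'))"

class hadamard_space = cat0_space + complete_space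

definition geodesics_from :: "'a::metric_space \<Rightarrow> (real \<Rightarrow> 'a) set" where
  "geodesics_from x = {\<gamma>. const_speed_geodesic \<gamma> \<and> \<gamma> 0 = x}"

text \<open>
  In a Hadamard space the closest point on the (compact, convex) image of a geodesic exists and
  is unique, so the choice operator returns the metric projection. The library's
  \<open>closest_point\<close> is confined to Euclidean spaces.
\<close>

definition geodesic_proj :: "(real \<Rightarrow> 'a::metric_space) \<Rightarrow> 'a \<Rightarrow> 'a" where
  "geodesic_proj \<gamma> y =
     (SOME p. p \<in> \<gamma> ` {0..1} \<and> (\<forall>q\<in>\<gamma> ` {0..1}. dist y p \<le> dist y q))"


section \<open>Weak convergence and the weak topology\<close>

definition weakly_converges :: "(nat \<Rightarrow> 'a::metric_space) \<Rightarrow> 'a \<Rightarrow> bool" where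
  "weakly_converges X x \<longleftrightarrow>
     (\<forall>\<gamma>\<in>geodesics_from x. (\<lambda>n. geodesic_proj \<gamma> (X n)) \<longlonglongrightarrow> x)"

definition weakly_open :: "'a::metric_space set \<Rightarrow> bool" where
  "weakly_open U \<longleftrightarrow>
     (\<forall>x\<in>U. \<exists>\<epsilon>>0. \<exists>G. finite G \<and> G \<subseteq> geodesics_from x \<and>
        {y. \<forall>\<gamma>\<in>G. dist x (geodesic_proj \<gamma> y) < \<epsilon>} \<subseteq> U)"

definition weak_topology :: "'a::metric_space topology" where
  "weak_topology = topology weakly_open"

lemma istopology_weakly_open: "istopology weakly_open"
  unfolding istopology_def
proof (intro conjI allI impI)
  fix S T :: "'a set"
  assume S: "weakly_open S" and T: "weakly_open T"
  show "weakly_open (S \<inter> T)"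
    unfolding weakly_open_def
  proof
    fix x assume x: "x \<in> S \<inter> T"
    from bspec[OF S[unfolded weakly_open_def] IntD1[OF x]]
    obtain e G where G: "e > 0" "finite G" "G \<subseteq> geodesics_from x"
        "{y. \<forall>\<gamma>\<in>G. dist x (geodesic_proj \<gamma> y) < e} \<subseteq> S"
      by (elim exE conjE)
    from bspec[OF T[unfolded weakly_open_def] IntD2[OF x]]
    obtain e' G' where G': "e' > 0" "finite G'" "G' \<subseteq> geodesics_from x"
        "{y. \<forall>\<gamma>\<in>G'. dist x (geodesic_proj \<gamma> y) < e'} \<subseteq> T"
      by (elim exE conjE)
    show "\<exists>\<epsilon>>0. \<exists>G. finite G \<and> G \<subseteq> geodesics_from x \<and>
        {y. \<forall>\<gamma>\<in>G. dist x (geodesic_proj \<gamma> y) < \<epsilon>} \<subseteq> S \<inter> T"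
    proof (intro exI conjI)
      show "min e e' > 0" "finite (G \<union> G')" "G \<union> G' \<subseteq> geodesics_from x"
        using G(1-3) G'(1-3) by simp_all
      show "{y. \<forall>\<gamma>\<in>G \<union> G'. dist x (geodesic_proj \<gamma> y) < min e e'} \<subseteq> S \<inter> T"
      proof
        fix y assume "y \<in> {y. \<forall>\<gamma>\<in>G \<union> G'. dist x (geodesic_proj \<gamma> y) < min e e'}"
        then have "y \<in> {y. \<forall>\<gamma>\<in>G. dist x (geodesic_proj \<gamma> y) < e}"
            "y \<in> {y. \<forall>\<gamma>\<in>G'. dist x (geodesic_proj \<gamma> y) < e'}"
          by simp_all
        then show "y \<in> S \<inter> T"
          using G(4) G'(4) by (intro IntI) (erule (1) subsetD[rotated])+
      qed
    qed
  qed
next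
  fix \<K> :: "'a set set"
  assume *: "\<forall>K\<in>\<K>. weakly_open K"
  show "weakly_open (\<Union>\<K>)"
    unfolding weakly_open_def
  proof
    fix x assume "x \<in> \<Union>\<K>"
    then obtain K where K: "K \<in> \<K>" "x \<in> K" by (rule UnionE)
    from bspec[OF bspec[OF * K(1), unfolded weakly_open_def] K(2)]
    obtain e G where G: "e > 0" "finite G" "G \<subseteq> geodesics_from x"
        "{y. \<forall>\<gamma>\<in>G. dist x (geodesic_proj \<gamma> y) < e} \<subseteq> K"
      by (elim exE conjE)
    show "\<exists>\<epsilon>>0. \<exists>G. finite G \<and> G \<subseteq> geodesics_from x \<and>
        {y. \<forall>\<gamma>\<in>G. dist x (geodesic_proj \<gamma> y) < \<epsilon>} \<subseteq> \<Union>\<K>"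
      using G(1-3) order_trans[OF G(4) Union_upper[OF K(1)]]
      by (intro exI[of _ e] exI[of _ G] conjI)
  qed
qed

lemma openin_weak_topology: "openin weak_topology U \<longleftrightarrow> weakly_open U"
  by (simp add: weak_topology_def istopology_weakly_open)

lemma topspace_weak_topology: "topspace weak_topology = UNIV"
proof -
  have "weakly_open (UNIV :: 'a set)"
    unfolding weakly_open_def
  proof
    fix x :: 'a
    show "\<exists>\<epsilon>>0. \<exists>G. finite G \<and> G \<subseteq> geodesics_from x \<and>
        {y. \<forall>\<gamma>\<in>G. dist x (geodesic_proj \<gamma> y) < \<epsilon>} \<subseteq> UNIV"
      by (rule exI[of _ 1], rule conjI, simp, rule exI[of _ "{}"], simp)
  qed
  then have "UNIV \<subseteq> topspace (weak_topology :: 'a topology)"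
    by (intro openin_subset) (simp add: openin_weak_topology)
  then show ?thesis
    by (rule top.extremum_uniqueI)
qed


section \<open>Kakavandi convergence and the Kakavandi topology\<close>

text \<open>
  \<open>quasi_inner x z y w\<close> is $\langle\overrightarrow{xz},\overrightarrow{yw}\rangle$ and
  \<open>based_quasi_inner x z y\<close> is $\langle\overrightarrow{xz},\overrightarrow{xy}\rangle$.
  The sign of the four-point formula is opposite to the one that yields
  $\langle\overrightarrow{xz},\overrightarrow{xy}\rangle =
  \frac12 (d(x,z)^2 + d(x,y)^2 - d(z,y)^2)$, which in a Hilbert space is the inner product of
  $z - x$ and $y - x$. The latter sign is used for the based form. As that form only occurs inside
  an absolute value or in a limit to zero, the choice of sign is immaterial.
\<close>

definition quasi_inner :: "'a::metric_space \<Rightarrow> 'a \<Rightarrow> 'a \<Rightarrow> 'a \<Rightarrow> real" where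
  "quasi_inner x z y w =
     ((dist x y)\<^sup>2 + (dist z w)\<^sup>2 - (dist x w)\<^sup>2 - (dist z y)\<^sup>2) / 2"

definition based_quasi_inner :: "'a::metric_space \<Rightarrow> 'a \<Rightarrow> 'a \<Rightarrow> real" where
  "based_quasi_inner x z y = ((dist x z)\<^sup>2 + (dist x y)\<^sup>2 - (dist z y)\<^sup>2) / 2"

lemma based_quasi_inner_eq: "based_quasi_inner x z y = - quasi_inner x z x y"
  by (simp add: based_quasi_inner_def quasi_inner_def dist_commute field_simps)

definition kakavandi_converges :: "(nat \<Rightarrow> 'a::metric_space) \<Rightarrow> 'a \<Rightarrow> bool" where
  "kakavandi_converges X x \<longleftrightarrow> (\<forall>y. (\<lambda>n. based_quasi_inner x (X n) y) \<longlonglongrightarrow> 0)"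

definition kakavandi_nbhd :: "'a::metric_space \<Rightarrow> 'a \<Rightarrow> real \<Rightarrow> 'a set" where
  "kakavandi_nbhd x y \<epsilon> = {z. \<bar>based_quasi_inner x z y\<bar> < \<epsilon>}"

definition kakavandi_topology :: "'a::metric_space topology" where
  "kakavandi_topology = topology_generated_by {kakavandi_nbhd x y \<epsilon> | x y \<epsilon>. \<epsilon> > 0}"

lemma topspace_kakavandi_topology: "topspace kakavandi_topology = UNIV"
proof (rule set_eqI)
  fix x :: 'a
  have "x \<in> kakavandi_nbhd x x 1"
    by (simp add: kakavandi_nbhd_def based_quasi_inner_def)
  moreover have "kakavandi_nbhd x x 1 \<in> {kakavandi_nbhd x y \<epsilon> | x y \<epsilon>. \<epsilon> > 0}"
    by (rule CollectI, rule exI[of _ x], rule exI[of _ x], rule exI[of _ 1]) simp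
  ultimately show "x \<in> topspace kakavandi_topology \<longleftrightarrow> x \<in> UNIV"
    unfolding kakavandi_topology_def topology_generated_by_topspace
    by (simp only: UNIV_I simp_thms) (rule UnionI)
qed

end

theory Submission
  imports Defs
begin

text \<open>
  Both parts rest on elementary estimates along a single geodesic.

  Let \<open>\<gamma>\<close> be a geodesic from \<open>x\<close>, let \<open>p = P\<^sub>\<gamma> z\<close>, and let \<open>y\<close> be the point of \<open>\<gamma>\<close> at distance
  \<open>\<epsilon>\<close> from \<open>x\<close>. If \<open>d(x, p) \<ge> \<epsilon>\<close>, then \<open>y\<close> lies between \<open>x\<close> and \<open>p\<close>, and since in a CAT(0) space
  the distance to \<open>z\<close> is quasiconvex along geodesics while \<open>p\<close> minimises it, \<open>d(z, y) \<le> d(z, x)\<close>.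
  The based quasi-inner product of \<open>z\<close> and \<open>y\<close> at \<open>x\<close> is then at least \<open>\<epsilon>\<^sup>2 / 2\<close>. In other words a
  single subbasic Kakavandi neighbourhood \<open>W(x, y; \<epsilon>\<^sup>2 / 2)\<close> already lies in the subbasic weak
  neighbourhood \<open>{z. d(x, P\<^sub>\<gamma> z) < \<epsilon>}\<close> (lemma \<open>kakavandi_nbhd_subset_weak_nbhd\<close>). Since \<open>y\<close> does not
  depend on \<open>z\<close>, this yields the inclusion of topologies and also that Kakavandi convergence
  implies weak convergence, in every Hadamard space.

  Local compactness turns weak convergence into metric convergence, which in turn implies
  Kakavandi convergence by continuity of the distance. For if infinitely many \<open>x\<^sub>n\<close> have distance
  at least \<open>\<epsilon>\<close> from \<open>x\<close>, the points at distance \<open>\<epsilon>\<close> from \<open>x\<close> on geodesics from \<open>x\<close> to these \<open>x\<^sub>n\<close>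
  accumulate at some \<open>l\<close>, because small balls around \<open>x\<close> are compact. Along a subsequence, walking
  from \<open>x\<close> to \<open>l\<close> then shortens the distance to \<open>x\<^sub>n\<close> by almost \<open>\<epsilon>\<close>, and so the projection of \<open>x\<^sub>n\<close>
  to the geodesic from \<open>x\<close> to \<open>l\<close> stays away from \<open>x\<close> (lemma \<open>weakly_converges_imp_LIMSEQ\<close>).
\<close>

section \<open>Geodesics and projections\<close>

lemma const_speed_geodesicD:
  assumes "const_speed_geodesic \<gamma>" "s \<in> {0..1}" "t \<in> {0..1}"
  shows "dist (\<gamma> s) (\<gamma> t) = \<bar>s - t\<bar> * dist (\<gamma> 0) (\<gamma> 1)"
  using assms unfolding const_speed_geodesic_def by blast

lemma compact_geodesic_image:
  fixes \<gamma> :: "real \<Rightarrow> 'a::metric_space"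
  assumes "const_speed_geodesic \<gamma>"
  shows "compact (\<gamma> ` {0..1})"
proof (rule compact_continuous_image)
  have "(dist (\<gamma> 0) (\<gamma> 1))-lipschitz_on {0..1} \<gamma>"
    by (rule lipschitz_onI)
      (subst const_speed_geodesicD[OF assms], simp_all add: dist_real_def mult.commute)
  then show "continuous_on {0..1} \<gamma>"
    by (rule lipschitz_on_continuous_on)
qed simp

lemma
  fixes \<gamma> :: "real \<Rightarrow> 'a::metric_space"
  assumes "const_speed_geodesic \<gamma>"
  shows geodesic_proj_in_image: "geodesic_proj \<gamma> y \<in> \<gamma> ` {0..1}"
    and geodesic_proj_le: "t \<in> {0..1} \<Longrightarrow> dist y (geodesic_proj \<gamma> y) \<le> dist y (\<gamma> t)"
proof -
  have "\<exists>p\<in>\<gamma> ` {0..1}. \<forall>q\<in>\<gamma> ` {0..1}. dist y p \<le> dist y q"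
    by (rule continuous_attains_inf[OF compact_geodesic_image[OF assms]])
      (auto intro!: continuous_intros)
  then have "\<exists>p. p \<in> \<gamma> ` {0..1} \<and> (\<forall>q\<in>\<gamma> ` {0..1}. dist y p \<le> dist y q)"
    by blast
  from someI_ex[OF this]
  show "geodesic_proj \<gamma> y \<in> \<gamma> ` {0..1}"
    and "t \<in> {0..1} \<Longrightarrow> dist y (geodesic_proj \<gamma> y) \<le> dist y (\<gamma> t)"
    by (auto simp: geodesic_proj_def)
qed

lemma geodesic_joins_initial_segment:
  fixes \<gamma> :: "real \<Rightarrow> 'a::metric_space"
  assumes "const_speed_geodesic \<gamma>" "a \<in> {0..1}"
  shows "geodesic_joins (\<lambda>s. \<gamma> (s * a)) (\<gamma> 0) (\<gamma> a)"
proof -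
  have in01: "s * a \<in> {0..1}" if "s \<in> {0..1}" for s
    using that assms(2) by (auto simp: mult_le_one)
  have "dist (\<gamma> (s * a)) (\<gamma> (t * a)) = \<bar>s - t\<bar> * dist (\<gamma> 0) (\<gamma> a)"
    if "s \<in> {0..1}" "t \<in> {0..1}" for s t
  proof -
    have "dist (\<gamma> (s * a)) (\<gamma> (t * a)) = \<bar>s * a - t * a\<bar> * dist (\<gamma> 0) (\<gamma> 1)"
      using that by (intro const_speed_geodesicD[OF assms(1)] in01)
    also have "\<bar>s * a - t * a\<bar> = \<bar>s - t\<bar> * a"
      using assms(2) by (simp add: abs_mult flip: left_diff_distrib)
    also have "\<dots> * dist (\<gamma> 0) (\<gamma> 1) = \<bar>s - t\<bar> * dist (\<gamma> 0) (\<gamma> a)"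
      using assms(2) const_speed_geodesicD[OF assms(1), of 0 a] by simp
    finally show ?thesis .
  qed
  then show ?thesis
    by (simp add: geodesic_joins_def const_speed_geodesic_def)
qed

lemma geodesic_point_at_distance:
  fixes x y :: "'a::cat0_space"
  assumes "0 \<le> r" "r \<le> dist x y"
  obtains z where "dist x z = r" "dist z y = dist x y - r"
proof (cases "x = y")
  case True
  with assms show ?thesis by (intro that[of x]) auto
next
  case False
  obtain \<gamma> where "geodesic_joins \<gamma> x y"
    using geodesic_exists[of x y] by blast
  then have \<gamma>: "const_speed_geodesic \<gamma>" "\<gamma> 0 = x" "\<gamma> 1 = y"
    by (auto simp: geodesic_joins_def)
  define t where "t = r / dist x y"
  have t: "t \<in> {0..1}" "t * dist x y = r"
    using assms False by (auto simp: t_def)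
  show ?thesis
  proof (rule that)
    show "dist x (\<gamma> t) = r"
      using const_speed_geodesicD[OF \<gamma>(1), of 0 t] t \<gamma> by simp
    show "dist (\<gamma> t) y = dist x y - r"
      using const_speed_geodesicD[OF \<gamma>(1), of t 1] t \<gamma> by (simp add: algebra_simps)
  qed
qed


section \<open>Quasiconvexity of the distance to a point\<close>

lemma exists_comparison_triangle:
  assumes "0 \<le> a" "0 \<le> b" "0 \<le> c" "a \<le> b + c" "b \<le> a + c" "c \<le> a + b"
  obtains p q r :: "real ^ 2"
  where "norm (p - q) = a" "norm (q - r) = b" "norm (r - p) = c"
proof -
  \<comment> \<open>The law of cosines fixes the first coordinate of the third vertex. For \<open>a = 0\<close> the
     division yields \<open>0\<close>, which is a correct choice because then \<open>b = c\<close>.\<close>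
  define u where "u = (a\<^sup>2 + c\<^sup>2 - b\<^sup>2) / (2 * a)"
  have "a = 0 \<Longrightarrow> u = 0"
    by (simp add: u_def)
  have au: "2 * a * u = a\<^sup>2 + c\<^sup>2 - b\<^sup>2"
    using assms by (cases "a = 0") (auto simp: u_def)
  have "\<bar>a - c\<bar>\<^sup>2 \<le> b\<^sup>2" "b\<^sup>2 \<le> (a + c)\<^sup>2"
    using assms by (intro power_mono; linarith)+
  then have "2 * a * \<bar>u\<bar> \<le> 2 * a * c"
    using au by (simp add: abs_if power2_eq_square algebra_simps split: if_splits)
  then have "\<bar>u\<bar> \<le> c"
    using assms \<open>a = 0 \<Longrightarrow> u = 0\<close> by (cases "a = 0") auto
  then have "u\<^sup>2 \<le> c\<^sup>2"
    using assms by (simp add: abs_le_square_iff[symmetric])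
  define v where "v = sqrt (c\<^sup>2 - u\<^sup>2)"
  have v: "v\<^sup>2 = c\<^sup>2 - u\<^sup>2"
    using \<open>u\<^sup>2 \<le> c\<^sup>2\<close> by (simp add: v_def)
  have norm_vec2: "norm w = sqrt ((w $ 1)\<^sup>2 + (w $ 2)\<^sup>2)" for w :: "real ^ 2"
    by (simp add: norm_vec_def L2_set_def sum_2)
  show ?thesis
  proof (rule that)
    show "norm (vector [0, 0] - vector [a, 0] :: real ^ 2) = a"
      using assms by (simp add: norm_vec2)
    have "(a - u)\<^sup>2 + v\<^sup>2 = b\<^sup>2"
      using au v by (simp add: power2_eq_square algebra_simps)
    then show "norm (vector [a, 0] - vector [u, v] :: real ^ 2) = b"
      using assms by (simp add: norm_vec2)
    show "norm (vector [u, v] - vector [0, 0] :: real ^ 2) = c"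
      using assms v by (simp add: norm_vec2)
  qed
qed

text \<open>
  The distance to the opposite vertex is convex along the side of the Euclidean comparison
  triangle, hence bounded by its maximum at the two ends.
\<close>

lemma dist_geodesic_le_max:
  fixes x y z :: "'a::cat0_space"
  assumes \<alpha>: "geodesic_joins \<alpha> x y" and s: "s \<in> {0..1}"
  shows "dist (\<alpha> s) z \<le> max (dist x z) (dist y z)"
proof -
  obtain \<beta> \<gamma> where \<beta>: "geodesic_joins \<beta> y z" and \<gamma>: "geodesic_joins \<gamma> z x"
    using geodesic_exists by metis
  obtain p q r :: "real ^ 2"
    where pqr: "norm (p - q) = dist x y" "norm (q - r) = dist y z" "norm (r - p) = dist z x"
  proof (rule exists_comparison_triangle)
    show "dist x y \<le> dist y z + dist z x" "dist y z \<le> dist x y + dist z x"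
      "dist z x \<le> dist x y + dist y z"
      using dist_triangle[of x y z] dist_triangle[of y z x] dist_triangle[of z x y]
      by (simp_all add: dist_commute)
  qed auto
  define m where "m = max (dist x z) (dist y z)"
  have "dist (\<alpha> s) (\<beta> 1) \<le> norm (((1 - s) *\<^sub>R p + s *\<^sub>R q) - ((1 - 1) *\<^sub>R q + 1 *\<^sub>R r))"
    by (rule cat0_inequality[OF \<alpha> \<beta> \<gamma> pqr s]) simp
  also have "\<beta> 1 = z"
    using \<beta> by (simp add: geodesic_joins_def)
  also have "((1 - s) *\<^sub>R p + s *\<^sub>R q) - ((1 - 1) *\<^sub>R q + 1 *\<^sub>R r)
      = (1 - s) *\<^sub>R (p - r) + s *\<^sub>R (q - r)"
    by (simp add: algebra_simps)
  also have "norm \<dots> \<le> (1 - s) * norm (p - r) + s * norm (q - r)"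
    by (rule norm_triangle_le) (use s in simp)
  also have "\<dots> = (1 - s) * dist x z + s * dist y z"
    using pqr by (simp add: norm_minus_commute dist_commute)
  also have "\<dots> \<le> (1 - s) * m + s * m"
    using s by (intro add_mono mult_left_mono) (auto simp: m_def)
  finally show ?thesis
    by (simp add: m_def algebra_simps)
qed


section \<open>Kakavandi neighbourhoods inside weak neighbourhoods\<close>

text \<open>
  The point \<open>y\<close> is the one on \<open>\<gamma>\<close> at distance \<open>\<epsilon>\<close> from \<open>x\<close>. A \<open>z\<close> whose projection has distance at
  least \<open>\<epsilon>\<close> from \<open>x\<close> is no farther from \<open>y\<close> than from \<open>x\<close>, so that the other two squares add a
  nonnegative amount to the summand \<open>d(x, y)\<^sup>2 = \<epsilon>\<^sup>2\<close> in the quasi-inner product. If \<open>\<gamma>\<close> is shorter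
  than \<open>\<epsilon>\<close>, there is no such \<open>z\<close> and any \<open>y\<close> will do.
\<close>

lemma kakavandi_nbhd_subset_weak_nbhd:
  fixes x :: "'a::cat0_space"
  assumes \<gamma>: "\<gamma> \<in> geodesics_from x" and "\<epsilon> > 0"
  obtains y where "kakavandi_nbhd x y (\<epsilon>\<^sup>2 / 2) \<subseteq> {z. dist x (geodesic_proj \<gamma> z) < \<epsilon>}"
proof -
  have geo: "const_speed_geodesic \<gamma>" and x: "\<gamma> 0 = x"
    using \<gamma> by (auto simp: geodesics_from_def)
  define L where "L = dist (\<gamma> 0) (\<gamma> 1)"
  have dist_x: "dist x (\<gamma> t) = t * L" if "t \<in> {0..1}" for t
    using const_speed_geodesicD[OF geo, of 0 t] that by (simp add: x L_def)
  have "\<epsilon>\<^sup>2 / 2 \<le> \<bar>based_quasi_inner x z (\<gamma> (\<epsilon> / L))\<bar>"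
    if far: "\<epsilon> \<le> dist x (geodesic_proj \<gamma> z)" for z
  proof -
    obtain a where a: "a \<in> {0..1}" and p: "geodesic_proj \<gamma> z = \<gamma> a"
      using geodesic_proj_in_image[OF geo] by blast
    have "\<epsilon> \<le> a * L"
      using far a by (simp add: p dist_x)
    then have "a * L > 0"
      using \<open>\<epsilon> > 0\<close> by linarith
    then have pos: "a > 0" "L > 0"
      using a by (auto simp: zero_less_mult_iff)
    have le: "\<epsilon> / L \<le> a"
      using \<open>\<epsilon> \<le> a * L\<close> pos by (simp add: pos_divide_le_eq)
    define s where "s = \<epsilon> / L / a"
    have s: "s \<in> {0..1}"
      using \<open>\<epsilon> \<le> a * L\<close> pos \<open>\<epsilon> > 0\<close> by (simp add: s_def pos_divide_le_eq mult.commute)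
    have "dist (\<gamma> (s * a)) z \<le> max (dist (\<gamma> 0) z) (dist (\<gamma> a) z)"
      by (rule dist_geodesic_le_max[OF geodesic_joins_initial_segment[OF geo a] s])
    also have "dist (\<gamma> a) z \<le> dist (\<gamma> 0) z"
      using geodesic_proj_le[OF geo, of 0 z] by (simp add: p dist_commute)
    then have "max (dist (\<gamma> 0) z) (dist (\<gamma> a) z) = dist x z"
      by (simp add: x)
    also have "s * a = \<epsilon> / L"
      using pos by (simp add: s_def)
    finally have "(dist z (\<gamma> (\<epsilon> / L)))\<^sup>2 \<le> (dist x z)\<^sup>2"
      by (intro power_mono) (simp_all add: dist_commute)
    moreover have "dist x (\<gamma> (\<epsilon> / L)) = \<epsilon>"
    proof (subst dist_x)
      have "0 \<le> \<epsilon> / L" "\<epsilon> / L \<le> 1"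
        using order_trans[OF le] a pos \<open>\<epsilon> > 0\<close> by (simp_all del: divide_le_eq_1_pos)
      then show "\<epsilon> / L \<in> {0..1}"
        by (simp only: atLeastAtMost_iff)
    qed (use pos in simp)
    ultimately have "\<epsilon>\<^sup>2 \<le> (dist x z)\<^sup>2 + (dist x (\<gamma> (\<epsilon> / L)))\<^sup>2 - (dist z (\<gamma> (\<epsilon> / L)))\<^sup>2"
      by (simp only: le_diff_eq add.commute add_left_mono)
    then have "\<epsilon>\<^sup>2 / 2 \<le> based_quasi_inner x z (\<gamma> (\<epsilon> / L))"
      unfolding based_quasi_inner_def by (rule divide_right_mono) simp
    then show ?thesis
      by (rule order_trans[OF _ abs_ge_self])
  qed
  then have "kakavandi_nbhd x (\<gamma> (\<epsilon> / L)) (\<epsilon>\<^sup>2 / 2) \<subseteq> {z. dist x (geodesic_proj \<gamma> z) < \<epsilon>}"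
    unfolding kakavandi_nbhd_def by (meson Collect_mono not_le)
  then show ?thesis by (rule that)
qed

lemma weakly_open_imp_openin_kakavandi:
  fixes U :: "'a::cat0_space set"
  assumes "weakly_open U"
  shows "openin kakavandi_topology U"
proof (subst openin_subopen, rule ballI)
  fix x assume "x \<in> U"
  from bspec[OF assms[unfolded weakly_open_def] this]
  obtain \<epsilon> G where "\<epsilon> > 0" "finite G" "G \<subseteq> geodesics_from x"
      and sub: "{y. \<forall>\<gamma>\<in>G. dist x (geodesic_proj \<gamma> y) < \<epsilon>} \<subseteq> U"
    by (elim exE conjE)
  have "\<exists>y. kakavandi_nbhd x y (\<epsilon>\<^sup>2 / 2) \<subseteq> {z. dist x (geodesic_proj \<gamma> z) < \<epsilon>}" if "\<gamma> \<in> G" for \<gamma>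
    by (rule kakavandi_nbhd_subset_weak_nbhd[OF subsetD[OF \<open>G \<subseteq> geodesics_from x\<close> that] \<open>\<epsilon> > 0\<close>])
      (rule exI)
  then obtain y where y: "kakavandi_nbhd x (y \<gamma>) (\<epsilon>\<^sup>2 / 2) \<subseteq> {z. dist x (geodesic_proj \<gamma> z) < \<epsilon>}"
    if "\<gamma> \<in> G" for \<gamma>
    by metis
  let ?V = "(\<Inter>\<gamma>\<in>G. kakavandi_nbhd x (y \<gamma>) (\<epsilon>\<^sup>2 / 2)) \<inter> topspace kakavandi_topology"
  show "\<exists>V. openin kakavandi_topology V \<and> x \<in> V \<and> V \<subseteq> U"
  proof (intro exI conjI)
    have "openin kakavandi_topology (kakavandi_nbhd x (y \<gamma>) (\<epsilon>\<^sup>2 / 2))" for \<gamma>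
      unfolding kakavandi_topology_def
      by (rule topology_generated_by_Basis, intro CollectI exI conjI, rule refl)
        (rule half_gt_zero[OF zero_less_power[OF \<open>\<epsilon> > 0\<close>]])
    with \<open>finite G\<close> show "openin kakavandi_topology ?V"
      by (intro openin_INT)
    show "x \<in> ?V"
      using \<open>\<epsilon> > 0\<close>
      by (simp add: topspace_kakavandi_topology kakavandi_nbhd_def based_quasi_inner_def)
    show "?V \<subseteq> U"
      using y sub by blast
  qed
qed

lemma kakavandi_imp_weakly_converges:
  fixes x :: "'a::cat0_space"
  assumes "kakavandi_converges X x"
  shows "weakly_converges X x"
  unfolding weakly_converges_def
proof (intro ballI tendstoI)
  fix \<gamma> \<epsilon> assume \<gamma>: "\<gamma> \<in> geodesics_from x" and "\<epsilon> > (0::real)"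
  then obtain y where y: "kakavandi_nbhd x y (\<epsilon>\<^sup>2 / 2) \<subseteq> {z. dist x (geodesic_proj \<gamma> z) < \<epsilon>}"
    by (rule kakavandi_nbhd_subset_weak_nbhd)
  have "(\<lambda>n. based_quasi_inner x (X n) y) \<longlonglongrightarrow> 0"
    using assms by (simp add: kakavandi_converges_def)
  then have "\<forall>\<^sub>F n in sequentially. dist (based_quasi_inner x (X n) y) 0 < \<epsilon>\<^sup>2 / 2"
    using \<open>\<epsilon> > 0\<close> by (intro tendstoD) auto
  then show "\<forall>\<^sub>F n in sequentially. dist (geodesic_proj \<gamma> (X n)) x < \<epsilon>"
    by eventually_elim (use y in \<open>auto simp: kakavandi_nbhd_def dist_commute\<close>)
qed


section \<open>Locally compact spaces\<close>

lemma locally_compact_space_compact_cball: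
  fixes x :: "'a::metric_space"
  assumes "locally_compact_space (euclidean :: 'a topology)"
  obtains r where "r > 0" "compact (cball x r)"
proof -
  have "\<forall>x::'a. \<exists>U. open U \<and> (\<exists>K. compact K \<and> x \<in> U \<and> U \<subseteq> K)"
    using assms by (simp add: locally_compact_space_def)
  then obtain U K where U: "open U" "x \<in> U" "U \<subseteq> K" and K: "compact K"
    by meson
  obtain r where r: "r > 0" "cball x r \<subseteq> U"
    using U by (meson open_contains_cball)
  then have "compact (K \<inter> cball x r)"
    using K by (intro compact_Int_closed) auto
  moreover have "K \<inter> cball x r = cball x r"
    using r U by auto
  ultimately show ?thesis
    using r that by simp
qed

lemma weakly_converges_imp_LIMSEQ:
  fixes x :: "'a::cat0_space"
  assumes weak: "weakly_converges X x" and "R > 0" and compact: "compact (cball x R)"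
  shows "X \<longlonglongrightarrow> x"
proof (rule ccontr)
  assume "\<not> X \<longlonglongrightarrow> x"
  then obtain e where "e > 0" and e: "\<not> (\<forall>\<^sub>F n in sequentially. dist (X n) x < e)"
    by (auto simp: tendsto_iff)
  define \<epsilon> where "\<epsilon> = min e R"
  have \<epsilon>: "\<epsilon> > 0" "\<epsilon> \<le> e" "\<epsilon> \<le> R"
    using \<open>e > 0\<close> \<open>R > 0\<close> by (auto simp: \<epsilon>_def)
  have "\<exists>\<^sub>\<infinity>n. \<not> dist (X n) x < e"
    using e by (simp add: frequently_def cofinite_eq_sequentially)
  then have "infinite {n. \<not> dist (X n) x < e}"
    by (simp add: frequently_cofinite)
  then obtain r :: "nat \<Rightarrow> nat" where r: "strict_mono r" "\<And>n. \<not> dist (X (r n)) x < e"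
    using infinite_enumerate by blast
  have far: "\<epsilon> \<le> dist x (X (r n))" for n
    using r(2)[of n] \<epsilon> by (simp add: dist_commute)
  have "\<forall>n. \<exists>z. dist x z = \<epsilon> \<and> dist z (X (r n)) = dist x (X (r n)) - \<epsilon>"
    using geodesic_point_at_distance[OF _ far] \<epsilon> by (metis less_imp_le)
  then obtain z where z: "\<And>n. dist x (z n) = \<epsilon>"
      "\<And>n. dist (z n) (X (r n)) = dist x (X (r n)) - \<epsilon>"
    by metis
  have "\<forall>n. z n \<in> cball x R"
    using z \<epsilon> by simp
  with compact obtain l r' where "strict_mono (r' :: nat \<Rightarrow> nat)" and l: "(z \<circ> r') \<longlonglongrightarrow> l"
    unfolding compact_def by blast
  obtain \<gamma> where "geodesic_joins \<gamma> x l"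
    using geodesic_exists[of x l] by blast
  then have \<gamma>: "const_speed_geodesic \<gamma>" "\<gamma> 0 = x" "\<gamma> 1 = l"
    by (auto simp: geodesic_joins_def)
  \<comment> \<open>Compare \<open>d(x\<^sub>n, p) \<le> d(x\<^sub>n, l)\<close> for the projection \<open>p\<close> with the detour from \<open>x\<^sub>n\<close> to \<open>l\<close> through
     the point at distance \<open>\<epsilon>\<close> from \<open>x\<close>.\<close>
  have bound: "\<epsilon> - dist (z n) l \<le> dist (geodesic_proj \<gamma> (X (r n))) x" for n
    using geodesic_proj_le[OF \<gamma>(1), of 1 "X (r n)"] z(2)[of n] \<gamma>(3)
      dist_triangle[of "X (r n)" l "z n"]
      dist_triangle[of x "X (r n)" "geodesic_proj \<gamma> (X (r n))"]
    by (simp add: dist_commute)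
  have "(\<lambda>n. \<epsilon> - dist ((z \<circ> r') n) l) \<longlonglongrightarrow> \<epsilon> - dist l l"
    by (intro tendsto_intros l)
  moreover have "(\<lambda>n. geodesic_proj \<gamma> (X n)) \<longlonglongrightarrow> x"
    using weak \<gamma> by (auto simp: weakly_converges_def geodesics_from_def)
  then have "(\<lambda>n. geodesic_proj \<gamma> (X ((r \<circ> r') n))) \<longlonglongrightarrow> x"
    using LIMSEQ_subseq_LIMSEQ[OF _ strict_mono_o[OF r(1) \<open>strict_mono r'\<close>]]
    unfolding comp_def by blast
  then have "(\<lambda>n. dist (geodesic_proj \<gamma> (X ((r \<circ> r') n))) x) \<longlonglongrightarrow> dist x x"
    by (intro tendsto_intros)
  ultimately have "\<epsilon> - dist l l \<le> dist x x"
    by (rule LIMSEQ_le) (use bound in auto)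
  with \<epsilon> show False by simp
qed

lemma LIMSEQ_imp_kakavandi_converges:
  assumes "X \<longlonglongrightarrow> x"
  shows "kakavandi_converges X x"
  unfolding kakavandi_converges_def
proof
  fix y
  have "(\<lambda>n. based_quasi_inner x (X n) y) \<longlonglongrightarrow> based_quasi_inner x x y"
    unfolding based_quasi_inner_def by (intro tendsto_intros assms) auto
  then show "(\<lambda>n. based_quasi_inner x (X n) y) \<longlonglongrightarrow> 0"
    by (simp add: based_quasi_inner_def)
qed

theorem theorem14:
  shows "(\<forall>U :: 'a::hadamard_space set.
            openin weak_topology U \<longrightarrow> openin kakavandi_topology U) \<and>
         (locally_compact_space (euclidean :: 'a topology) \<longrightarrow>
            (\<forall>(X :: nat \<Rightarrow> 'a) x. kakavandi_converges X x \<longleftrightarrow> weakly_converges X x))"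
proof (intro conjI allI impI)
  fix U :: "'a set"
  assume "openin weak_topology U"
  then show "openin kakavandi_topology U"
    by (simp add: openin_weak_topology weakly_open_imp_openin_kakavandi)
next
  fix X :: "nat \<Rightarrow> 'a" and x :: 'a
  assume "locally_compact_space (euclidean :: 'a topology)"
  then obtain R where "R > 0" "compact (cball x R)"
    by (rule locally_compact_space_compact_cball)
  then show "kakavandi_converges X x \<longleftrightarrow> weakly_converges X x"
    using kakavandi_imp_weakly_converges weakly_converges_imp_LIMSEQ
      LIMSEQ_imp_kakavandi_converges by blast
qed

end
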